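(* Let $\phi:\mathbb{R}_0^+\times X\to X$ be a continuous semiflow on a compact metric space $(X,d)$. Then $$\bar{h}_{\mathrm{r}}(\phi)=\bar{h}_{\mathrm{s}}(\phi)=h_{top}(\phi).$$
   Context: A semiflow on $X$ is a map $\phi:\mathbb{R}_0^+\times X\to X$, $\phi_t(x)=\phi(t,x)$, with $\phi_0=\mathrm{id}$ and $\phi_{t+s}=\phi_t\circ\phi_s$. For $\delta>0$ put $d_\delta^1(x,y)=\inf\{d(\phi_{s_1}(x),\phi_{s_2}(y)):s_1,s_2\in[0,\delta)\}$. Let $\varepsilon>0$, $T>0$. A set $F\subseteq X$ is $(\phi,T,\varepsilon,\delta)$-spanning for $d_\delta^1$ if for all $x\in X$ there exists $y\in F$ such that $d_\delta^1(\phi_t(x),\phi_t(y))<\varepsilon$ for all $t\in[0,T]$. A set $E\subseteq X$ is $(\phi,T,\varepsilon,\delta)$-separated for $d_\delta^1$ if for all $x,y\in E$ with $x\ne y$ there exists $t\in[0,T]$ such that $d_\delta^1(\phi_t(x),\phi_t(y))\ge\varepsilon$. Let $\bar r(\phi,T,\varepsilon,\delta)$ be the infimum of the cardinalities of $(\phi,T,\varepsilon,\delta)$-spanning sets for $d_\delta^1$, and $\bar s(\phi,T,\varepsilon,\delta)$ the supremum of the cardinalities of $(\phi,T,\varepsilon,\delta)$-separated sets for $d_\delta^1$. Define $$\bar h_{\mathrm r}(\phi)=\lim_{\delta\to0^+}\lim_{\varepsilon\to0^+}\limsup_{T\to+\infty}\frac1T\log\bar r(\phi,T,\varepsilon,\delta),\qquad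 \bar h_{\mathrm s}(\phi)=\lim_{\delta\to0^+}\lim_{\varepsilon\to0^+}\limsup_{T\to+\infty}\frac1T\log\bar s(\phi,T,\varepsilon,\delta),$$ with $\log\infty=\infty$ (the limits exist in $[0,\infty]$ by monotonicity). Bowen's entropy $h_{top}(\phi)$: a set $F\subseteq X$ is $(\phi,T,\varepsilon)$-spanning if for all $x\in X$ there is $y\in F$ with $d(\phi_t(x),\phi_t(y))<\varepsilon$ for all $t\in[0,T]$; a set $E\subseteq X$ is $(\phi,T,\varepsilon)$-separated if for all distinct $x,y\in E$ there is $t\in[0,T]$ with $d(\phi_t(x),\phi_t(y))\ge\varepsilon$. Let $r(\phi,T,\varepsilon)$ be the infimum of cardinalities of $(\phi,T,\varepsilon)$-spanning sets, $s(\phi,T,\varepsilon)$ the supremum of cardinalities of $(\phi,T,\varepsilon)$-separated sets, $h_{\mathrm r}(\phi)=\lim_{\varepsilon\to0^+}\limsup_{T\to+\infty}\frac1T\log r(\phi,T,\varepsilon)$ and $h_{\mathrm s}(\phi)=\lim_{\varepsilon\to0^+}\limsup_{T\to+\infty}\frac1T\log s(\phi,T,\varepsilon)$. For a continuous semiflow on a compact metric space $h_{\mathrm r}(\phi)=h_{\mathrm s}(\phi)$ (Bowen), and $h_{top}(\phi)$ denotes this common value. *)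

theory Defs
  imports "HOL-Analysis.Analysis"
begin

section \<open>Continuous semiflows\<close>

text \<open>The phase space is a subset \<open>X\<close> of a metric space, with the restricted metric. Only the values
  \<open>\<phi> t x\<close> with \<open>t \<ge> 0\<close> and \<open>x \<in> X\<close> matter.\<close>

definition semiflow_on :: "'a set \<Rightarrow> (real \<Rightarrow> 'a \<Rightarrow> 'a) \<Rightarrow> bool" where
  "semiflow_on X \<phi> \<longleftrightarrow>
     (\<forall>t\<ge>0. \<forall>x\<in>X. \<phi> t x \<in> X) \<and>
     (\<forall>x\<in>X. \<phi> 0 x = x) \<and>
     (\<forall>t\<ge>0. \<forall>s\<ge>0. \<forall>x\<in>X. \<phi> (t + s) x = \<phi> t (\<phi> s x))"

definition continuous_semiflow_on :: "'a::metric_space set \<Rightarrow> (real \<Rightarrow> 'a \<Rightarrow> 'a) \<Rightarrow> bool" where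
  "continuous_semiflow_on X \<phi> \<longleftrightarrow>
     semiflow_on X \<phi> \<and> continuous_on ({0..} \<times> X) (\<lambda>(t, x). \<phi> t x)"

section \<open>Spanning and separated sets\<close>

text \<open>The set \<open>{0..<\<delta>}\<close> is nonempty only for \<open>\<delta> > 0\<close>, so the infimum is meaningful only then.\<close>

definition d1 :: "(real \<Rightarrow> 'a::metric_space \<Rightarrow> 'a) \<Rightarrow> real \<Rightarrow> 'a \<Rightarrow> 'a \<Rightarrow> real" where
  "d1 \<phi> \<delta> x y = (INF (s1, s2) \<in> {0..<\<delta>} \<times> {0..<\<delta>}. dist (\<phi> s1 x) (\<phi> s2 y))"

text \<open>The distance \<open>\<rho>\<close> is a parameter: it is instantiated with \<open>dist\<close> for Bowen's notions and with
  \<open>d1 \<phi> \<delta>\<close> for the modified ones.\<close>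

definition spanning :: "('a \<Rightarrow> 'a \<Rightarrow> real) \<Rightarrow> 'a set \<Rightarrow> (real \<Rightarrow> 'a \<Rightarrow> 'a) \<Rightarrow> real \<Rightarrow> real \<Rightarrow> 'a set \<Rightarrow> bool"
  where "spanning \<rho> X \<phi> T \<epsilon> F \<longleftrightarrow>
    F \<subseteq> X \<and> (\<forall>x\<in>X. \<exists>y\<in>F. \<forall>t\<in>{0..T}. \<rho> (\<phi> t x) (\<phi> t y) < \<epsilon>)"

definition separated :: "('a \<Rightarrow> 'a \<Rightarrow> real) \<Rightarrow> 'a set \<Rightarrow> (real \<Rightarrow> 'a \<Rightarrow> 'a) \<Rightarrow> real \<Rightarrow> real \<Rightarrow> 'a set \<Rightarrow> bool"
  where "separated \<rho> X \<phi> T \<epsilon> E \<longleftrightarrow>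
    E \<subseteq> X \<and> (\<forall>x\<in>E. \<forall>y\<in>E. x \<noteq> y \<longrightarrow> (\<exists>t\<in>{0..T}. \<rho> (\<phi> t x) (\<phi> t y) \<ge> \<epsilon>))"

definition ecard :: "'a set \<Rightarrow> enat" where
  "ecard A = (if finite A then enat (card A) else \<infinity>)"

definition span_number :: "('a \<Rightarrow> 'a \<Rightarrow> real) \<Rightarrow> 'a set \<Rightarrow> (real \<Rightarrow> 'a \<Rightarrow> 'a) \<Rightarrow> real \<Rightarrow> real \<Rightarrow> enat"
  where "span_number \<rho> X \<phi> T \<epsilon> = (INF F \<in> {F. spanning \<rho> X \<phi> T \<epsilon> F}. ecard F)"

definition sep_number :: "('a \<Rightarrow> 'a \<Rightarrow> real) \<Rightarrow> 'a set \<Rightarrow> (real \<Rightarrow> 'a \<Rightarrow> 'a) \<Rightarrow> real \<Rightarrow> real \<Rightarrow> enat"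
  where "sep_number \<rho> X \<phi> T \<epsilon> = (SUP E \<in> {E. separated \<rho> X \<phi> T \<epsilon> E}. ecard E)"

section \<open>Entropies\<close>

text \<open>The value at \<open>0\<close> is relevant only for \<open>X = {}\<close>.\<close>

definition ln_enat :: "enat \<Rightarrow> ereal" where
  "ln_enat n = (case n of enat k \<Rightarrow> if k = 0 then -\<infinity> else ereal (ln (real k)) | \<infinity> \<Rightarrow> \<infinity>)"

definition growth_rate :: "(real \<Rightarrow> enat) \<Rightarrow> ereal" where
  "growth_rate N = Limsup at_top (\<lambda>T. ereal (1 / T) * ln_enat (N T))"

definition h_span :: "'a::metric_space set \<Rightarrow> (real \<Rightarrow> 'a \<Rightarrow> 'a) \<Rightarrow> ereal" where
  "h_span X \<phi> = Lim (at_right 0) (\<lambda>\<epsilon>. growth_rate (\<lambda>T. span_number dist X \<phi> T \<epsilon>))"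

definition h_sep :: "'a::metric_space set \<Rightarrow> (real \<Rightarrow> 'a \<Rightarrow> 'a) \<Rightarrow> ereal" where
  "h_sep X \<phi> = Lim (at_right 0) (\<lambda>\<epsilon>. growth_rate (\<lambda>T. sep_number dist X \<phi> T \<epsilon>))"

text \<open>Specified only if \<open>h_span X \<phi> = h_sep X \<phi>\<close>, which holds for continuous semiflows on compact
  spaces by Bowen's theorem.\<close>

definition h_top :: "'a::metric_space set \<Rightarrow> (real \<Rightarrow> 'a \<Rightarrow> 'a) \<Rightarrow> ereal" where
  "h_top X \<phi> = (THE h. h = h_span X \<phi> \<and> h = h_sep X \<phi>)"

definition h_bar_span :: "'a::metric_space set \<Rightarrow> (real \<Rightarrow> 'a \<Rightarrow> 'a) \<Rightarrow> ereal" where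
  "h_bar_span X \<phi> = Lim (at_right 0) (\<lambda>\<delta>. Lim (at_right 0) (\<lambda>\<epsilon>.
     growth_rate (\<lambda>T. span_number (d1 \<phi> \<delta>) X \<phi> T \<epsilon>)))"

definition h_bar_sep :: "'a::metric_space set \<Rightarrow> (real \<Rightarrow> 'a \<Rightarrow> 'a) \<Rightarrow> ereal" where
  "h_bar_sep X \<phi> = Lim (at_right 0) (\<lambda>\<delta>. Lim (at_right 0) (\<lambda>\<epsilon>.
     growth_rate (\<lambda>T. sep_number (d1 \<phi> \<delta>) X \<phi> T \<epsilon>)))"

section \<open>Existence of the limits\<close>

text \<open>\<open>Lim\<close> is unspecified for divergent functions, so we record that all limits above exist.\<close>

lemma tendsto_at_right_0_antimono:
  fixes f :: "real \<Rightarrow> ereal"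
  assumes "\<And>x y. 0 < x \<Longrightarrow> x \<le> y \<Longrightarrow> f y \<le> f x"
  shows "(f \<longlongrightarrow> (SUP x\<in>{0<..}. f x)) (at_right 0)"
proof (rule increasing_tendsto)
  show "\<forall>\<^sub>F x in at_right 0. f x \<le> (SUP x\<in>{0<..}. f x)"
    using eventually_at_right_less[of 0] by (rule eventually_mono) (auto intro: SUP_upper)
next
  fix a assume "a < (SUP x\<in>{0<..}. f x)"
  then obtain y where "y > 0" "a < f y" by (auto simp: less_SUP_iff)
  then have "a < f x" if "0 < x" "x < y" for x
    using assms[of x y] that by (meson less_imp_le less_le_trans)
  then show "\<forall>\<^sub>F x in at_right 0. a < f x"
    using \<open>y > 0\<close> by (auto simp: eventually_at_right_field)
qed

lemma tendsto_Lim_at_right_0_antimono: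
  fixes f :: "real \<Rightarrow> ereal"
  assumes "\<And>x y. 0 < x \<Longrightarrow> x \<le> y \<Longrightarrow> f y \<le> f x"
  shows "(f \<longlongrightarrow> Lim (at_right 0) f) (at_right 0)"
proof -
  have lim: "(f \<longlongrightarrow> (SUP x\<in>{0<..}. f x)) (at_right 0)"
    using assms by (rule tendsto_at_right_0_antimono)
  then have "Lim (at_right 0) f = (SUP x\<in>{0<..}. f x)"
    by (intro tendsto_Lim) auto
  with lim show ?thesis by simp
qed

lemma ln_enat_mono: "m \<le> n \<Longrightarrow> ln_enat m \<le> ln_enat n"
  by (auto simp: ln_enat_def split: enat.split)

lemma growth_rate_mono:
  assumes "\<And>T. M T \<le> N T"
  shows "growth_rate M \<le> growth_rate N"
  unfolding growth_rate_def
  by (intro Limsup_mono eventually_mono[OF eventually_gt_at_top[of 0]]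
        ereal_mult_left_mono ln_enat_mono assms) auto

lemma span_number_antimono:
  assumes "\<And>x y. \<rho> x y \<le> \<rho>' x y" "\<epsilon>' \<le> \<epsilon>"
  shows "span_number \<rho> X \<phi> T \<epsilon> \<le> span_number \<rho>' X \<phi> T \<epsilon>'"
proof -
  have "\<rho> x y < \<epsilon>" if "\<rho>' x y < \<epsilon>'" for x y
    using that assms(1)[of x y] assms(2) by linarith
  then have "spanning \<rho> X \<phi> T \<epsilon> F" if "spanning \<rho>' X \<phi> T \<epsilon>' F" for F
    using that unfolding spanning_def by meson
  then show ?thesis
    unfolding span_number_def by (intro INF_superset_mono) auto
qed

lemma sep_number_antimono:
  assumes "\<And>x y. \<rho> x y \<le> \<rho>' x y" "\<epsilon>' \<le> \<epsilon>"
  shows "sep_number \<rho> X \<phi> T \<epsilon> \<le> sep_number \<rho>' X \<phi> T \<epsilon>'"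
proof -
  have "\<rho>' x y \<ge> \<epsilon>'" if "\<rho> x y \<ge> \<epsilon>" for x y
    using that assms(1)[of x y] assms(2) by linarith
  then have "separated \<rho>' X \<phi> T \<epsilon>' E" if "separated \<rho> X \<phi> T \<epsilon> E" for E
    using that unfolding separated_def by meson
  then show ?thesis
    unfolding sep_number_def by (intro SUP_subset_mono) auto
qed

lemma d1_antimono:
  assumes "0 < \<delta>" "\<delta> \<le> \<delta>'"
  shows "d1 \<phi> \<delta>' x y \<le> d1 \<phi> \<delta> x y"
  unfolding d1_def
  by (rule cINF_superset_mono) (use assms in \<open>auto intro!: bdd_belowI[where m = 0]\<close>)

lemma h_limit_exists:
  "((\<lambda>\<epsilon>. growth_rate (\<lambda>T. span_number \<rho> X \<phi> T \<epsilon>)) \<longlongrightarrow>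
     Lim (at_right 0) (\<lambda>\<epsilon>. growth_rate (\<lambda>T. span_number \<rho> X \<phi> T \<epsilon>))) (at_right 0)"
    (is "(?f \<longlongrightarrow> _) _")
  "((\<lambda>\<epsilon>. growth_rate (\<lambda>T. sep_number \<rho> X \<phi> T \<epsilon>)) \<longlongrightarrow>
     Lim (at_right 0) (\<lambda>\<epsilon>. growth_rate (\<lambda>T. sep_number \<rho> X \<phi> T \<epsilon>))) (at_right 0)"
    (is "(?g \<longlongrightarrow> _) _")
proof -
  show "(?f \<longlongrightarrow> Lim (at_right 0) ?f) (at_right 0)"
    by (rule tendsto_Lim_at_right_0_antimono, rule growth_rate_mono, rule span_number_antimono) auto
  show "(?g \<longlongrightarrow> Lim (at_right 0) ?g) (at_right 0)"
    by (rule tendsto_Lim_at_right_0_antimono, rule growth_rate_mono, rule sep_number_antimono) auto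
qed

lemma h_bar_limit_exists:
  "((\<lambda>\<delta>. Lim (at_right 0) (\<lambda>\<epsilon>. growth_rate (\<lambda>T. span_number (d1 \<phi> \<delta>) X \<phi> T \<epsilon>))) \<longlongrightarrow>
     h_bar_span X \<phi>) (at_right 0)" (is "(?f \<longlongrightarrow> _) _")
  "((\<lambda>\<delta>. Lim (at_right 0) (\<lambda>\<epsilon>. growth_rate (\<lambda>T. sep_number (d1 \<phi> \<delta>) X \<phi> T \<epsilon>))) \<longlongrightarrow>
     h_bar_sep X \<phi>) (at_right 0)" (is "(?g \<longlongrightarrow> _) _")
proof -
  have f: "?f y \<le> ?f x" if "0 < x" "x \<le> y" for x y
  proof (rule tendsto_le[OF _ h_limit_exists(1) h_limit_exists(1)])
    show "\<forall>\<^sub>F \<epsilon> in at_right 0. growth_rate (\<lambda>T. span_number (d1 \<phi> y) X \<phi> T \<epsilon>)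
        \<le> growth_rate (\<lambda>T. span_number (d1 \<phi> x) X \<phi> T \<epsilon>)"
      by (rule always_eventually) (intro allI growth_rate_mono span_number_antimono d1_antimono that order_refl)
  qed simp
  have g: "?g y \<le> ?g x" if "0 < x" "x \<le> y" for x y
  proof (rule tendsto_le[OF _ h_limit_exists(2) h_limit_exists(2)])
    show "\<forall>\<^sub>F \<epsilon> in at_right 0. growth_rate (\<lambda>T. sep_number (d1 \<phi> y) X \<phi> T \<epsilon>)
        \<le> growth_rate (\<lambda>T. sep_number (d1 \<phi> x) X \<phi> T \<epsilon>)"
      by (rule always_eventually) (intro allI growth_rate_mono sep_number_antimono d1_antimono that order_refl)
  qed simp
  show "(?f \<longlongrightarrow> h_bar_span X \<phi>) (at_right 0)"
    unfolding h_bar_span_def using f by (rule tendsto_Lim_at_right_0_antimono)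
  show "(?g \<longlongrightarrow> h_bar_sep X \<phi>) (at_right 0)"
    unfolding h_bar_sep_def using g by (rule tendsto_Lim_at_right_0_antimono)
qed

end

theory Submission
  imports Defs
begin

text \<open>On a compact space a semiflow moves every point only slightly in a short time: for each
  \<open>\<eta> > 0\<close> there is \<open>\<delta> > 0\<close> such that all points move by less than \<open>\<eta>\<close> during \<open>[0, \<delta>)\<close>
  (\<open>uniformly_small_displacement\<close>). Two points whose orbit pieces of length \<open>\<delta>\<close> come within \<open>\<eta>\<close> of
  each other are then less than \<open>3 * \<eta>\<close> apart (\<open>small_d1_imp_small_dist\<close>), while conversely
  \<open>d1 \<phi> \<delta> \<le> dist\<close> always holds on the space. Hence spanning and separated sets for \<open>dist\<close> and for
  \<open>d1 \<phi> \<delta>\<close> are comparable up to a change of \<open>\<epsilon>\<close> by a factor \<open>3\<close>, once \<open>\<delta>\<close> is small compared with \<open>\<epsilon>\<close>.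

  This choice of \<open>\<delta>\<close> after \<open>\<epsilon>\<close> runs against the order of the two limits, in which \<open>\<epsilon>\<close> tends to \<open>0\<close>
  for a fixed \<open>\<delta>\<close>. It is harmless because the growth rates are antitone in both parameters: the
  iterated limits are iterated suprema, so each single pair \<open>(\<delta>, \<epsilon>)\<close> gives a lower bound
  (\<open>iterated_Lim_growth_rate_eq\<close>). The modified entropies therefore coincide with the two Bowen
  entropies, and these are equal by the classical comparison
  \<open>r(T, \<epsilon>) \<le> s(T, \<epsilon>) \<le> r(T, \<epsilon> / 2)\<close>, which rests on the triangle inequality for \<open>dist\<close>. Since
  \<open>d1 \<phi> \<delta>\<close> need not satisfy a triangle inequality, the two modified entropies are compared through
  \<open>dist\<close> and not with each other.\<close>

section \<open>Growth rates and iterated limits\<close>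

lemma Lim_at_right_0_antimono_eq_SUP:
  fixes f :: "real \<Rightarrow> ereal"
  assumes "\<And>x y. 0 < x \<Longrightarrow> x \<le> y \<Longrightarrow> f y \<le> f x"
  shows "Lim (at_right 0) f = (SUP x\<in>{0<..}. f x)"
  using tendsto_at_right_0_antimono[of f] assms by (intro tendsto_Lim) auto

lemma Lim_growth_rate_eq_SUP:
  fixes M :: "real \<Rightarrow> real \<Rightarrow> enat"
  assumes "\<And>\<epsilon> \<epsilon>' T. 0 < \<epsilon> \<Longrightarrow> \<epsilon> \<le> \<epsilon>' \<Longrightarrow> M \<epsilon>' T \<le> M \<epsilon> T"
  shows "Lim (at_right 0) (\<lambda>\<epsilon>. growth_rate (M \<epsilon>)) = (SUP \<epsilon>\<in>{0<..}. growth_rate (M \<epsilon>))"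
  using assms by (intro Lim_at_right_0_antimono_eq_SUP growth_rate_mono)

text \<open>Each limit is a supremum over its parameter, so to bound the rates of \<open>M\<close> by the iterated limit it
  suffices to find one suitable pair \<open>(\<delta>, \<epsilon>)\<close> for each \<open>\<eta>\<close>; here \<open>\<delta>\<close> may depend on \<open>\<eta>\<close>.\<close>

lemma iterated_Lim_growth_rate_eq:
  fixes N :: "real \<Rightarrow> real \<Rightarrow> real \<Rightarrow> enat"
  assumes M: "\<And>\<epsilon> \<epsilon>' T. 0 < \<epsilon> \<Longrightarrow> \<epsilon> \<le> \<epsilon>' \<Longrightarrow> M \<epsilon>' T \<le> M \<epsilon> T"
    and N: "\<And>\<delta> \<delta>' \<epsilon> \<epsilon>' T. 0 < \<delta> \<Longrightarrow> \<delta> \<le> \<delta>' \<Longrightarrow> 0 < \<epsilon> \<Longrightarrow> \<epsilon> \<le> \<epsilon>' \<Longrightarrow> N \<delta>' \<epsilon>' T \<le> N \<delta> \<epsilon> T"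
    and NM: "\<And>\<delta> \<epsilon> T. 0 < \<delta> \<Longrightarrow> 0 < \<epsilon> \<Longrightarrow> N \<delta> \<epsilon> T \<le> M \<epsilon> T"
    and MN: "\<And>\<eta>. 0 < \<eta> \<Longrightarrow> \<exists>\<delta>>0. \<exists>\<epsilon>>0. \<forall>T. M \<eta> T \<le> N \<delta> \<epsilon> T"
  shows "Lim (at_right 0) (\<lambda>\<delta>. Lim (at_right 0) (\<lambda>\<epsilon>. growth_rate (N \<delta> \<epsilon>))) =
    Lim (at_right 0) (\<lambda>\<epsilon>. growth_rate (M \<epsilon>))" (is "Lim _ ?g = _")
proof -
  have g: "?g \<delta> = (SUP \<epsilon>\<in>{0<..}. growth_rate (N \<delta> \<epsilon>))" if "\<delta> > 0" for \<delta>
    using N[OF that order_refl] by (intro Lim_growth_rate_eq_SUP)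
  have "?g \<delta>' \<le> ?g \<delta>" if "0 < \<delta>" "\<delta> \<le> \<delta>'" for \<delta> \<delta>'
  proof -
    have "growth_rate (N \<delta>' \<epsilon>) \<le> growth_rate (N \<delta> \<epsilon>)" if "\<epsilon> > 0" for \<epsilon>
      using N[OF \<open>0 < \<delta>\<close> \<open>\<delta> \<le> \<delta>'\<close> that order_refl] by (intro growth_rate_mono)
    with that show ?thesis
      by (auto simp: g intro!: SUP_mono)
  qed
  then have "Lim (at_right 0) ?g = (SUP \<delta>\<in>{0<..}. ?g \<delta>)"
    by (rule Lim_at_right_0_antimono_eq_SUP)
  also have "\<dots> = (SUP \<delta>\<in>{0<..}. SUP \<epsilon>\<in>{0<..}. growth_rate (N \<delta> \<epsilon>))"
    by (intro SUP_cong) (auto simp: g)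
  also have "\<dots> = (SUP \<epsilon>\<in>{0<..}. growth_rate (M \<epsilon>))"
  proof (intro antisym SUP_least)
    fix \<delta> \<epsilon> :: real assume "\<delta> \<in> {0<..}" "\<epsilon> \<in> {0<..}"
    then show "growth_rate (N \<delta> \<epsilon>) \<le> (SUP \<epsilon>\<in>{0<..}. growth_rate (M \<epsilon>))"
      using NM[of \<delta> \<epsilon>] by (intro SUP_upper2[of \<epsilon>] growth_rate_mono) auto
  next
    fix \<eta> :: real assume "\<eta> \<in> {0<..}"
    then obtain \<delta> \<epsilon> where "\<delta> > 0" "\<epsilon> > 0" "\<And>T. M \<eta> T \<le> N \<delta> \<epsilon> T"
      using MN[of \<eta>] by auto
    then show "growth_rate (M \<eta>) \<le> (SUP \<delta>\<in>{0<..}. SUP \<epsilon>\<in>{0<..}. growth_rate (N \<delta> \<epsilon>))"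
      by (intro SUP_upper2[of \<delta>] SUP_upper2[of \<epsilon>] growth_rate_mono) auto
  qed
  also have "\<dots> = Lim (at_right 0) (\<lambda>\<epsilon>. growth_rate (M \<epsilon>))"
    using M by (rule Lim_growth_rate_eq_SUP[symmetric])
  finally show ?thesis .
qed

section \<open>Comparison of spanning and separated sets\<close>

lemma semiflow_on_closed: "semiflow_on X \<phi> \<Longrightarrow> t \<ge> 0 \<Longrightarrow> x \<in> X \<Longrightarrow> \<phi> t x \<in> X"
  by (simp add: semiflow_on_def)

text \<open>Only the distances between points of \<open>X\<close> matter, since orbits stay in \<open>X\<close>. Outside \<open>X\<close> the
  maps \<open>\<phi> t\<close> are arbitrary and \<open>d1 \<phi> \<delta> \<le> dist\<close> can fail, so the comparison has to be relative
  to \<open>X\<close>.\<close>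

lemma span_number_le:
  assumes "semiflow_on X \<phi>"
    and "\<And>x y. x \<in> X \<Longrightarrow> y \<in> X \<Longrightarrow> \<rho>' x y < \<epsilon>' \<Longrightarrow> \<rho> x y < \<epsilon>"
  shows "span_number \<rho> X \<phi> T \<epsilon> \<le> span_number \<rho>' X \<phi> T \<epsilon>'"
proof -
  have "spanning \<rho> X \<phi> T \<epsilon> F" if F: "spanning \<rho>' X \<phi> T \<epsilon>' F" for F
    unfolding spanning_def
  proof (intro conjI ballI)
    show "F \<subseteq> X" using F by (simp add: spanning_def)
    fix x assume "x \<in> X"
    with F obtain y where "y \<in> F" "\<forall>t\<in>{0..T}. \<rho>' (\<phi> t x) (\<phi> t y) < \<epsilon>'"
      unfolding spanning_def by blast
    with \<open>F \<subseteq> X\<close> \<open>x \<in> X\<close> show "\<exists>y\<in>F. \<forall>t\<in>{0..T}. \<rho> (\<phi> t x) (\<phi> t y) < \<epsilon>"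
      using assms(2) semiflow_on_closed[OF assms(1)] by (intro bexI[of _ y]) auto
  qed
  then show ?thesis
    unfolding span_number_def by (intro INF_superset_mono) auto
qed

lemma sep_number_le:
  assumes "semiflow_on X \<phi>"
    and "\<And>x y. x \<in> X \<Longrightarrow> y \<in> X \<Longrightarrow> \<rho>' x y < \<epsilon>' \<Longrightarrow> \<rho> x y < \<epsilon>"
  shows "sep_number \<rho> X \<phi> T \<epsilon> \<le> sep_number \<rho>' X \<phi> T \<epsilon>'"
proof -
  have "separated \<rho>' X \<phi> T \<epsilon>' E" if E: "separated \<rho> X \<phi> T \<epsilon> E" for E
    unfolding separated_def
  proof (intro conjI ballI impI)
    show "E \<subseteq> X" using E by (simp add: separated_def)
    fix x y assume xy: "x \<in> E" "y \<in> E" "x \<noteq> y"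
    with E obtain t where t: "t \<in> {0..T}" "\<rho> (\<phi> t x) (\<phi> t y) \<ge> \<epsilon>"
      unfolding separated_def by blast
    moreover have "\<phi> t x \<in> X" "\<phi> t y \<in> X"
      using xy t \<open>E \<subseteq> X\<close> semiflow_on_closed[OF assms(1)] by auto
    ultimately show "\<exists>t\<in>{0..T}. \<rho>' (\<phi> t x) (\<phi> t y) \<ge> \<epsilon>'"
      using assms(2)[of "\<phi> t x" "\<phi> t y"] by (intro bexI[of _ t]) (auto simp: not_less[symmetric])
  qed
  then show ?thesis
    unfolding sep_number_def by (intro SUP_subset_mono) auto
qed

section \<open>Bowen's theorem\<close>

text \<open>If the numbers of points in separated sets are bounded, a separated set with the largest
  possible number of points exists and is spanning: a point violating the spanning condition could
  be added to it.\<close>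

lemma span_number_le_sep_number:
  fixes \<phi> :: "real \<Rightarrow> 'a::metric_space \<Rightarrow> 'a"
  assumes "\<epsilon> > 0"
  shows "span_number dist X \<phi> T \<epsilon> \<le> sep_number dist X \<phi> T \<epsilon>"
proof (cases "sep_number dist X \<phi> T \<epsilon>")
  case (enat n)
  define A where "A = {E. separated dist X \<phi> T \<epsilon> E}"
  have bound: "finite E \<and> card E \<le> n" if "E \<in> A" for E
  proof -
    have "ecard E \<le> enat n"
      using that unfolding A_def enat[symmetric] sep_number_def by (intro SUP_upper) auto
    then show ?thesis by (auto simp: ecard_def split: if_splits)
  qed
  have "{} \<in> A" by (simp add: A_def separated_def)
  with bound obtain E where E: "E \<in> A" and max: "\<And>E'. E' \<in> A \<Longrightarrow> card E' \<le> card E"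
    using ex_has_greatest_nat[of "\<lambda>E. E \<in> A" "{}" card "Suc n"] by (auto simp: less_Suc_eq_le)
  have "spanning dist X \<phi> T \<epsilon> E"
    unfolding spanning_def
  proof (intro conjI ballI)
    show "E \<subseteq> X" using E by (simp add: A_def separated_def)
    fix x assume "x \<in> X"
    show "\<exists>y\<in>E. \<forall>t\<in>{0..T}. dist (\<phi> t x) (\<phi> t y) < \<epsilon>"
    proof (rule ccontr)
      assume none: "\<not> ?thesis"
      then have far: "\<exists>t\<in>{0..T}. dist (\<phi> t x) (\<phi> t y) \<ge> \<epsilon>" if "y \<in> E" for y
        using that by (force simp: not_less)
      have "x \<notin> E" using none assms by force
      have "insert x E \<in> A"
        using E far \<open>x \<in> X\<close> by (auto simp: A_def separated_def dist_commute)
      then have "card (insert x E) \<le> card E" by (rule max)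
      with \<open>x \<notin> E\<close> bound[OF E] show False by simp
    qed
  qed
  then have "span_number dist X \<phi> T \<epsilon> \<le> ecard E"
    unfolding span_number_def by (intro INF_lower) auto
  also have "\<dots> \<le> sep_number dist X \<phi> T \<epsilon>"
    using E unfolding sep_number_def A_def by (intro SUP_upper)
  finally show ?thesis .
qed simp

text \<open>By the triangle inequality, one point of a spanning set can be \<open>\<epsilon> / 2\<close>-close to at most one
  point of an \<open>\<epsilon>\<close>-separated set.\<close>

lemma sep_number_le_span_number_half:
  fixes \<phi> :: "real \<Rightarrow> 'a::metric_space \<Rightarrow> 'a"
  shows "sep_number dist X \<phi> T \<epsilon> \<le> span_number dist X \<phi> T (\<epsilon> / 2)"
  unfolding sep_number_def span_number_def
proof (intro SUP_least INF_greatest)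
  fix E F
  assume "E \<in> {E. separated dist X \<phi> T \<epsilon> E}" "F \<in> {F. spanning dist X \<phi> T (\<epsilon> / 2) F}"
  then have E: "separated dist X \<phi> T \<epsilon> E" and F: "spanning dist X \<phi> T (\<epsilon> / 2) F" by auto
  have "\<forall>x\<in>E. \<exists>y\<in>F. \<forall>t\<in>{0..T}. dist (\<phi> t x) (\<phi> t y) < \<epsilon> / 2"
    using E F unfolding separated_def spanning_def by blast
  then obtain f where f: "\<And>x. x \<in> E \<Longrightarrow> f x \<in> F"
    "\<And>x t. x \<in> E \<Longrightarrow> t \<in> {0..T} \<Longrightarrow> dist (\<phi> t x) (\<phi> t (f x)) < \<epsilon> / 2"
    by metis
  have "inj_on f E"
  proof (rule inj_onI, rule ccontr)
    fix x y assume xy: "x \<in> E" "y \<in> E" "f x = f y" "x \<noteq> y"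
    with E obtain t where "t \<in> {0..T}" "dist (\<phi> t x) (\<phi> t y) \<ge> \<epsilon>"
      unfolding separated_def by blast
    moreover have "dist (\<phi> t x) (\<phi> t y) < \<epsilon>"
      using f(2)[of x t] f(2)[of y t] xy \<open>t \<in> {0..T}\<close> by (auto intro: dist_triangle_half_l)
    ultimately show False by simp
  qed
  moreover have "f ` E \<subseteq> F" using f(1) by auto
  ultimately show "ecard E \<le> ecard F"
    by (auto simp: ecard_def card_inj_on_le dest: inj_on_finite)
qed

lemma h_span_eq_h_sep:
  fixes \<phi> :: "real \<Rightarrow> 'a::metric_space \<Rightarrow> 'a"
  shows "h_span X \<phi> = h_sep X \<phi>"
proof -
  have "h_span X \<phi> = (SUP \<epsilon>\<in>{0<..}. growth_rate (\<lambda>T. span_number dist X \<phi> T \<epsilon>))"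
    unfolding h_span_def by (intro Lim_growth_rate_eq_SUP span_number_antimono) auto
  also have "\<dots> = (SUP \<epsilon>\<in>{0<..}. growth_rate (\<lambda>T. sep_number dist X \<phi> T \<epsilon>))"
  proof (intro antisym SUP_mono)
    fix \<epsilon> :: real assume "\<epsilon> \<in> {0<..}"
    then show "\<exists>\<epsilon>'\<in>{0<..}. growth_rate (\<lambda>T. span_number dist X \<phi> T \<epsilon>)
        \<le> growth_rate (\<lambda>T. sep_number dist X \<phi> T \<epsilon>')"
      by (intro bexI[of _ \<epsilon>] growth_rate_mono span_number_le_sep_number) auto
    show "\<exists>\<epsilon>'\<in>{0<..}. growth_rate (\<lambda>T. sep_number dist X \<phi> T \<epsilon>)
        \<le> growth_rate (\<lambda>T. span_number dist X \<phi> T \<epsilon>')"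
      using \<open>\<epsilon> \<in> {0<..}\<close>
      by (intro bexI[of _ "\<epsilon> / 2"] growth_rate_mono sep_number_le_span_number_half) auto
  qed
  also have "\<dots> = h_sep X \<phi>"
    unfolding h_sep_def by (intro Lim_growth_rate_eq_SUP[symmetric] sep_number_antimono) auto
  finally show ?thesis .
qed

section \<open>The distance between orbit pieces\<close>

lemma d1_le_dist:
  assumes "semiflow_on X \<phi>" "x \<in> X" "y \<in> X" "\<delta> > 0"
  shows "d1 \<phi> \<delta> x y \<le> dist x y"
proof -
  have "d1 \<phi> \<delta> x y \<le> dist (\<phi> 0 x) (\<phi> 0 y)"
    unfolding d1_def
    by (rule cINF_lower2[where x = "(0, 0)"])
      (use assms in \<open>auto intro!: bdd_belowI[where m = 0]\<close>)
  with assms show ?thesis by (simp add: semiflow_on_def)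
qed

lemma uniformly_small_displacement:
  fixes \<phi> :: "real \<Rightarrow> 'a::metric_space \<Rightarrow> 'a"
  assumes "compact X" "continuous_semiflow_on X \<phi>" "\<eta> > 0"
  obtains \<delta> where "\<delta> > 0" "\<And>s x. s \<in> {0..<\<delta>} \<Longrightarrow> x \<in> X \<Longrightarrow> dist (\<phi> s x) x < \<eta>"
proof -
  \<comment> \<open>The bounded time interval makes the domain compact; its length \<open>1\<close> is arbitrary.\<close>
  have "uniformly_continuous_on ({0..1} \<times> X) (\<lambda>(t, x). \<phi> t x)"
    using assms unfolding continuous_semiflow_on_def
    by (intro compact_uniformly_continuous compact_Times compact_Icc)
      (auto elim: continuous_on_subset)
  then obtain d where d: "d > 0" "\<And>p q. p \<in> {0..1} \<times> X \<Longrightarrow> q \<in> {0..1} \<times> X \<Longrightarrow> dist q p < d \<Longrightarrow>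
      dist (case q of (t, x) \<Rightarrow> \<phi> t x) (case p of (t, x) \<Rightarrow> \<phi> t x) < \<eta>"
    using assms(3) unfolding uniformly_continuous_on_def by metis
  show thesis
  proof
    show "min 1 d > 0" using d by simp
    fix s x assume "s \<in> {0..<min 1 d}" "x \<in> X"
    then show "dist (\<phi> s x) x < \<eta>"
      using d(2)[of "(0, x)" "(s, x)"] assms(2)
      by (auto simp: dist_Pair_Pair dist_real_def continuous_semiflow_on_def semiflow_on_def)
  qed
qed

text \<open>A path from \<open>x\<close> to \<open>y\<close> made of three short pieces: along the orbit of \<open>x\<close>, across to the orbit
  of \<open>y\<close>, and back to \<open>y\<close>.\<close>

lemma small_d1_imp_small_dist:
  fixes \<phi> :: "real \<Rightarrow> 'a::metric_space \<Rightarrow> 'a"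
  assumes "\<delta> > 0" and displ: "\<And>s z. s \<in> {0..<\<delta>} \<Longrightarrow> z \<in> X \<Longrightarrow> dist (\<phi> s z) z < \<eta>"
    and "x \<in> X" "y \<in> X" "d1 \<phi> \<delta> x y < \<eta>"
  shows "dist x y < 3 * \<eta>"
proof -
  have "bdd_below ((\<lambda>(s1, s2). dist (\<phi> s1 x) (\<phi> s2 y)) ` ({0..<\<delta>} \<times> {0..<\<delta>}))"
    by (auto intro!: bdd_belowI[where m = 0])
  with assms(1,5) obtain s1 s2 where
    s: "s1 \<in> {0..<\<delta>}" "s2 \<in> {0..<\<delta>}" "dist (\<phi> s1 x) (\<phi> s2 y) < \<eta>"
    unfolding d1_def by (subst (asm) cINF_less_iff) auto
  have "dist x y \<le> dist x (\<phi> s1 x) + (dist (\<phi> s1 x) (\<phi> s2 y) + dist (\<phi> s2 y) y)"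
    by (meson add_left_mono dist_triangle order_trans)
  with s displ[of s1 x] displ[of s2 y] assms(3,4) show ?thesis
    by (simp add: dist_commute)
qed

text \<open>Comparability of \<open>dist\<close> and \<open>d1 \<phi> \<delta>\<close> in the form needed to pass from one entropy to the
  other.\<close>

lemma ex_small_d1_imp_small_dist:
  fixes \<phi> :: "real \<Rightarrow> 'a::metric_space \<Rightarrow> 'a"
  assumes "compact X" "continuous_semiflow_on X \<phi>" "\<eta> > 0"
  shows "\<exists>\<delta>>0. \<exists>\<epsilon>>0. \<forall>x\<in>X. \<forall>y\<in>X. d1 \<phi> \<delta> x y < \<epsilon> \<longrightarrow> dist x y < \<eta>"
proof -
  from assms have "\<eta> / 3 > 0" by simp
  then obtain \<delta> where "\<delta> > 0" "\<And>s x. s \<in> {0..<\<delta>} \<Longrightarrow> x \<in> X \<Longrightarrow> dist (\<phi> s x) x < \<eta> / 3"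
    using uniformly_small_displacement assms(1,2) by blast
  then have "\<forall>x\<in>X. \<forall>y\<in>X. d1 \<phi> \<delta> x y < \<eta> / 3 \<longrightarrow> dist x y < \<eta>"
    using small_d1_imp_small_dist[of \<delta> X \<phi> "\<eta> / 3"] by simp
  with \<open>\<delta> > 0\<close> \<open>\<eta> / 3 > 0\<close> show ?thesis by blast
qed

section \<open>Equality of the entropies\<close>

lemma h_bar_span_eq_h_span:
  fixes \<phi> :: "real \<Rightarrow> 'a::metric_space \<Rightarrow> 'a"
  assumes "compact X" "continuous_semiflow_on X \<phi>"
  shows "h_bar_span X \<phi> = h_span X \<phi>"
  unfolding h_bar_span_def h_span_def
proof (rule iterated_Lim_growth_rate_eq)
  have sf: "semiflow_on X \<phi>" using assms(2) by (simp add: continuous_semiflow_on_def)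
  show "span_number (d1 \<phi> \<delta>) X \<phi> T \<epsilon> \<le> span_number dist X \<phi> T \<epsilon>" if "\<delta> > 0" for \<delta> \<epsilon> T
    using sf d1_le_dist[OF sf _ _ that] by (intro span_number_le) (auto intro: le_less_trans)
  show "\<exists>\<delta>>0. \<exists>\<epsilon>>0. \<forall>T. span_number dist X \<phi> T \<eta> \<le> span_number (d1 \<phi> \<delta>) X \<phi> T \<epsilon>"
    if "\<eta> > 0" for \<eta>
    using ex_small_d1_imp_small_dist[OF assms that] span_number_le[OF sf] by meson
qed (auto intro!: span_number_antimono d1_antimono)

lemma h_bar_sep_eq_h_sep:
  fixes \<phi> :: "real \<Rightarrow> 'a::metric_space \<Rightarrow> 'a"
  assumes "compact X" "continuous_semiflow_on X \<phi>"
  shows "h_bar_sep X \<phi> = h_sep X \<phi>"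
  unfolding h_bar_sep_def h_sep_def
proof (rule iterated_Lim_growth_rate_eq)
  have sf: "semiflow_on X \<phi>" using assms(2) by (simp add: continuous_semiflow_on_def)
  show "sep_number (d1 \<phi> \<delta>) X \<phi> T \<epsilon> \<le> sep_number dist X \<phi> T \<epsilon>" if "\<delta> > 0" for \<delta> \<epsilon> T
    using sf d1_le_dist[OF sf _ _ that] by (intro sep_number_le) (auto intro: le_less_trans)
  show "\<exists>\<delta>>0. \<exists>\<epsilon>>0. \<forall>T. sep_number dist X \<phi> T \<eta> \<le> sep_number (d1 \<phi> \<delta>) X \<phi> T \<epsilon>"
    if "\<eta> > 0" for \<eta>
    using ex_small_d1_imp_small_dist[OF assms that] sep_number_le[OF sf] by meson
qed (auto intro!: sep_number_antimono d1_antimono)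

theorem theorem1:
  fixes X :: "'a::metric_space set" and \<phi> :: "real \<Rightarrow> 'a \<Rightarrow> 'a"
  assumes "compact X" and "continuous_semiflow_on X \<phi>"
  shows "h_bar_span X \<phi> = h_bar_sep X \<phi> \<and> h_bar_sep X \<phi> = h_top X \<phi>"
proof -
  have "h_top X \<phi> = h_sep X \<phi>"
    unfolding h_top_def h_span_eq_h_sep by simp
  with assms show ?thesis
    by (simp add: h_bar_span_eq_h_span h_bar_sep_eq_h_sep h_span_eq_h_sep)
qed

end
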